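(* Let $X$ be a continuous time irreducible Markov chain on $I=\{1,\ldots,n\}$ which is reversible with respect to the uniform distribution on $I$, and for $t\ge0$ let $P_t$ denote the law of $X(t)$. Fix real numbers $0<\kappa<1$ and $0<\alpha<\frac12$, set $\tilde\alpha=\frac12-\alpha$, and, on the interval $[0,\tilde\alpha]$, define the function $$F(\alpha_1)=-\alpha_1(1-\kappa)\log(1-\kappa)-(\tilde\alpha-\alpha_1)(1+\kappa)\log(1+\kappa)-\big(1-(1-\kappa)\alpha_1-(1+\kappa)(\tilde\alpha-\alpha_1)\big)\log\left(\frac{1-\tilde\alpha-\tilde\alpha\kappa+2\kappa\alpha_1}{1-\tilde\alpha}\right),$$ which takes non-positive values. Then, for every $t\ge0$, the entropy estimate $$H(P_t)>\log n+\max_{0\le\alpha_1\le\tilde\alpha}F(\alpha_1)$$ implies the lower bound $$|EQ(t)|\ge\alpha n.$$ Moreover, depending on the values of $\kappa$ and $\alpha$, the maximum $\max_{0\le\alpha_1\le\tilde\alpha}F(\alpha_1)$ is attained at $0$, $\tilde\alpha$ or $$\alpha_1^*:=\frac{(1-\kappa)^{-1/(2\kappa)}\Big((1-\tilde\alpha)\sqrt{1-\kappa}\,(1+\kappa)^{(1+\kappa)/(2\kappa)}-e(1-\kappa)^{1/(2\kappa)}(1-\tilde\alpha-\tilde\alpha\kappa)\Big)}{2e\kappa}.$$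
   Context: For $0<\kappa<1$ and $t\ge0$, $$EQ(t)=\Big\{a\in I:\;P_t(a)\in\Big(\frac{1-\kappa}{n},\frac{1+\kappa}{n}\Big)\Big\},$$ and $|EQ(t)|$ is its cardinality. The entropy of a probability measure $p$ on $I$ is $H(p)=-\sum_{a\in I}p(a)\log p(a)$ with $0\log 0=0$; logarithms are natural and $e$ in the formula for $\alpha_1^*$ is Euler's number. *)

theory Defs
  imports "HOL-Probability.Probability"
begin

definition transition_semigroup :: "'s set \<Rightarrow> (real \<Rightarrow> 's \<Rightarrow> 's \<Rightarrow> real) \<Rightarrow> bool" where
  "transition_semigroup S p \<longleftrightarrow>
     (\<forall>t\<ge>0. \<forall>a\<in>S. \<forall>b\<in>S. 0 \<le> p t a b) \<and>
     (\<forall>t\<ge>0. \<forall>a\<in>S. (\<Sum>b\<in>S. p t a b) = 1) \<and>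
     (\<forall>a\<in>S. \<forall>b\<in>S. p 0 a b = (if a = b then 1 else 0)) \<and>
     (\<forall>s\<ge>0. \<forall>t\<ge>0. \<forall>a\<in>S. \<forall>b\<in>S. p (s + t) a b = (\<Sum>c\<in>S. p s a c * p t c b)) \<and>
     (\<forall>a\<in>S. \<forall>b\<in>S. ((\<lambda>t. p t a b) \<longlongrightarrow> p 0 a b) (at_right 0))"

text \<open>
  A time-homogeneous continuous-time Markov chain on a finite state space with transition
  probabilities \<open>p t a b\<close>; times are the non-negative reals and the initial distribution is
  arbitrary. Conditional probabilities given null events carry no information, hence
  the positivity premise in the Markov property. Regularity of the sample paths is not assumed,
  as it plays no role for the one-dimensional marginals.
\<close>

locale finite_ctmc = prob_space M
  for M :: "'w measure" +
  fixes S :: "'s set" and X :: "real \<Rightarrow> 'w \<Rightarrow> 's" and p :: "real \<Rightarrow> 's \<Rightarrow> 's \<Rightarrow> real"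
  assumes finite_states: "finite S"
    and semigroup: "transition_semigroup S p"
    and rv: "\<And>t. 0 \<le> t \<Longrightarrow> X t \<in> measurable M (count_space S)"
    and markov: "\<And>s t a b U c. 0 \<le> s \<Longrightarrow> 0 \<le> t \<Longrightarrow> a \<in> S \<Longrightarrow> b \<in> S \<Longrightarrow>
      finite U \<Longrightarrow> U \<subseteq> {0..t} \<Longrightarrow>
      0 < \<P>(\<omega> in M. X t \<omega> = a \<and> (\<forall>u\<in>U. X u \<omega> = c u)) \<Longrightarrow>
      \<P>(\<omega> in M. X (t + s) \<omega> = b \<bar> X t \<omega> = a \<and> (\<forall>u\<in>U. X u \<omega> = c u)) = p s a b"

definition irreducible_chain :: "'s set \<Rightarrow> (real \<Rightarrow> 's \<Rightarrow> 's \<Rightarrow> real) \<Rightarrow> bool" where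
  "irreducible_chain S p \<longleftrightarrow> (\<forall>a\<in>S. \<forall>b\<in>S. \<exists>t\<ge>0. 0 < p t a b)"

definition reversible_wrt :: "('s \<Rightarrow> real) \<Rightarrow> 's set \<Rightarrow> (real \<Rightarrow> 's \<Rightarrow> 's \<Rightarrow> real) \<Rightarrow> bool" where
  "reversible_wrt \<pi> S p \<longleftrightarrow> (\<forall>t\<ge>0. \<forall>a\<in>S. \<forall>b\<in>S. \<pi> a * p t a b = \<pi> b * p t b a)"

definition law :: "'w measure \<Rightarrow> 's set \<Rightarrow> (real \<Rightarrow> 'w \<Rightarrow> 's) \<Rightarrow> real \<Rightarrow> 's measure" where
  "law M S X t = distr M (count_space S) (X t)"

text \<open>The convention \<open>0 log 0 = 0\<close> holds automatically for the product below.\<close>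

definition shannon_entropy :: "'s set \<Rightarrow> 's measure \<Rightarrow> real" where
  "shannon_entropy S \<mu> = - (\<Sum>a\<in>S. measure \<mu> {a} * ln (measure \<mu> {a}))"

definition EQ :: "real \<Rightarrow> nat \<Rightarrow> nat measure \<Rightarrow> nat set" where
  "EQ \<kappa> n \<mu> = {a \<in> {1..n}. measure \<mu> {a} \<in> {(1 - \<kappa>) / real n <..< (1 + \<kappa>) / real n}}"

text \<open>The parameter \<open>\<beta>\<close> below stands for \<open>1/2 - \<alpha>\<close>.\<close>

definition F :: "real \<Rightarrow> real \<Rightarrow> real \<Rightarrow> real" where
  "F \<kappa> \<beta> x =
     - x * (1 - \<kappa>) * ln (1 - \<kappa>)
     - (\<beta> - x) * (1 + \<kappa>) * ln (1 + \<kappa>)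
     - (1 - (1 - \<kappa>) * x - (1 + \<kappa>) * (\<beta> - x))
       * ln ((1 - \<beta> - \<beta> * \<kappa> + 2 * \<kappa> * x) / (1 - \<beta>))"

definition alpha1_star :: "real \<Rightarrow> real \<Rightarrow> real" where
  "alpha1_star \<kappa> \<beta> =
     (1 - \<kappa>) powr (- (1 / (2 * \<kappa>)))
     * ((1 - \<beta>) * sqrt (1 - \<kappa>) * (1 + \<kappa>) powr ((1 + \<kappa>) / (2 * \<kappa>))
        - exp 1 * (1 - \<kappa>) powr (1 / (2 * \<kappa>)) * (1 - \<beta> - \<beta> * \<kappa>))
     / (2 * exp 1 * \<kappa>)"

end

theory Submission
  imports Defs
begin

text \<open>
  Write \<open>\<phi> u = u * ln u\<close> and \<open>u a = n * P a\<close>, so that \<open>ln n - H(P)\<close> is the average of \<open>\<phi> (u a)\<close>.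
  For \<open>x \<in> {0..\<beta>}\<close> the number \<open>m\<close> inside the logarithm of \<open>F\<close> is the level at which
  weights \<open>x\<close>, \<open>\<beta> - x\<close>, \<open>1 - \<beta>\<close> at \<open>1 - \<kappa>\<close>, \<open>1 + \<kappa>\<close>, \<open>m\<close> have mean \<open>1\<close>, and \<open>- F x\<close> is the
  corresponding mean of \<open>\<phi>\<close>. As \<open>\<beta> < 1/2\<close>, \<open>m\<close> lies between \<open>1 - \<kappa>\<close> and \<open>1 + \<kappa>\<close>, so the gap
  between \<open>\<phi>\<close> and its tangent at \<open>m\<close> is at least its value at \<open>1 - \<kappa>\<close> on the states of low
  probability, and at least its value at \<open>1 + \<kappa>\<close> on those of high probability. If there are enough
  such states, averaging gives \<open>H(P) \<le> ln n + F x\<close> for a suitable \<open>x\<close>. The location of the maximum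
  follows from concavity of \<open>F\<close>.
\<close>

section \<open>Convexity of \<open>u * ln u\<close>\<close>

lemma mult_ln_ge_tangent:
  fixes u v :: real
  assumes "0 \<le> u" "0 < v"
  shows "u * ln v + u - v \<le> u * ln u"
proof (cases "u = 0")
  case False
  with assms have "u > 0" by simp
  \<comment> \<open>Multiplied by \<open>u\<close>, this is the tangent inequality.\<close>
  have "ln (v / u) \<le> v / u - 1"
    using assms \<open>u > 0\<close> by (intro ln_le_minus_one) simp
  hence "u * (ln v - ln u) \<le> u * (v / u - 1)"
    using assms \<open>u > 0\<close> by (simp add: ln_div)
  thus ?thesis using \<open>u > 0\<close> by (simp add: algebra_simps)
qed (use assms in simp)

text \<open>The gap at \<open>u\<close> minus the gap at \<open>v\<close> is the gap between
  \<open>u * ln u\<close> and its tangent at \<open>v\<close>, plus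
  \<open>(ln v - ln m) * (u - v)\<close>, whose factors have the same sign.\<close>

lemma tangent_gap_mono:
  fixes m u v :: real
  assumes "0 \<le> u" "0 < v" "0 < m" "u \<le> v \<and> v \<le> m \<or> m \<le> v \<and> v \<le> u"
  shows "v * ln v - (v * ln m + v - m) \<le> u * ln u - (u * ln m + u - m)"
proof -
  have "(ln v - ln m) * (u - v) \<ge> 0"
    using assms by (auto intro: mult_nonpos_nonpos mult_nonneg_nonneg)
  thus ?thesis
    using mult_ln_ge_tangent[of u v] assms by (simp add: algebra_simps)
qed

section \<open>Sign, concavity and maximum of \<open>F\<close>\<close>

definition level :: "real \<Rightarrow> real \<Rightarrow> real \<Rightarrow> real" where
  "level \<kappa> \<beta> x = (1 - \<beta> - \<beta> * \<kappa> + 2 * \<kappa> * x) / (1 - \<beta>)"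

context
  fixes \<kappa> \<beta> :: real
  assumes kappa: "0 < \<kappa>" "\<kappa> < 1" and beta: "\<beta> < 1 / 2"
begin

lemma level_mult: "(1 - \<beta>) * level \<kappa> \<beta> x = 1 - (1 - \<kappa>) * x - (1 + \<kappa>) * (\<beta> - x)"
  using beta by (simp add: level_def field_simps)

text \<open>Here \<open>\<beta> < 1 / 2\<close> matters: \<open>(1 - \<beta>) * (level \<kappa>
  \<beta> x - 1) = \<kappa> * (2 * x - \<beta>)\<close>, and \<open>2 * x - \<beta>\<close> has
  modulus at most \<open>\<beta> < 1 - \<beta>\<close>.\<close>

lemma level_bounds:
  assumes "0 \<le> x" "x \<le> \<beta>"
  shows "1 - \<kappa> \<le> level \<kappa> \<beta> x" "level \<kappa> \<beta> x \<le> 1 + \<kappa>"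
proof -
  have "\<kappa> * (2 * x - \<beta>) \<le> \<kappa> * (1 - \<beta>)" "\<kappa> * (- (1 - \<beta>)) \<le> \<kappa> * (2 * x - \<beta>)"
    by (intro mult_left_mono; use kappa beta assms in simp)+
  thus "1 - \<kappa> \<le> level \<kappa> \<beta> x" "level \<kappa> \<beta> x \<le> 1 + \<kappa>"
    using beta by (simp_all add: level_def field_simps)
qed

lemma level_pos: "0 \<le> x \<Longrightarrow> x \<le> \<beta> \<Longrightarrow> 0 < level \<kappa> \<beta> x"
  using level_bounds(1)[of x] kappa by simp

lemma F_eq:
  "F \<kappa> \<beta> x = - (x * ((1 - \<kappa>) * ln (1 - \<kappa>)) + (\<beta> - x) * ((1 + \<kappa>) * ln (1 + \<kappa>))
     + (1 - \<beta>) * (level \<kappa> \<beta> x * ln (level \<kappa> \<beta> x)))"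
proof -
  have "F \<kappa> \<beta> x = - x * (1 - \<kappa>) * ln (1 - \<kappa>) - (\<beta> - x) * (1 + \<kappa>) * ln (1 + \<kappa>)
      - ((1 - \<beta>) * level \<kappa> \<beta> x) * ln (level \<kappa> \<beta> x)"
    unfolding level_mult by (simp add: F_def level_def)
  thus ?thesis by (simp add: algebra_simps)
qed

text \<open>Jensen's inequality at the mean \<open>1\<close>: the tangent of \<open>u * ln u\<close>
  there is \<open>u - 1\<close>, whose weighted mean vanishes by \<open>level_mult\<close>.\<close>

lemma F_nonpos:
  assumes "0 \<le> x" "x \<le> \<beta>"
  shows "F \<kappa> \<beta> x \<le> 0"
proof -
  have "x * ((1 - \<kappa>) * ln (1 - \<kappa>)) \<ge> x * (1 - \<kappa> - 1)"
    "(\<beta> - x) * ((1 + \<kappa>) * ln (1 + \<kappa>)) \<ge> (\<beta> - x) * (1 + \<kappa> - 1)"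
    "(1 - \<beta>) * (level \<kappa> \<beta> x * ln (level \<kappa> \<beta> x)) \<ge> (1 - \<beta>) * (level \<kappa> \<beta> x - 1)"
    using mult_ln_ge_tangent[of "1 - \<kappa>" 1] mult_ln_ge_tangent[of "1 + \<kappa>" 1]
      mult_ln_ge_tangent[of "level \<kappa> \<beta> x" 1] kappa beta assms level_pos[OF assms]
    by (intro mult_left_mono; simp)+
  moreover have "x * (1 - \<kappa> - 1) + (\<beta> - x) * (1 + \<kappa> - 1) + (1 - \<beta>) * (level \<kappa> \<beta> x - 1) = 0"
    using level_mult[of x] by (simp add: algebra_simps)
  ultimately show ?thesis unfolding F_eq by linarith
qed

text \<open>The derivative of \<open>F \<kappa> \<beta>\<close> at \<open>x\<close>, used only
  through the tangent inequality below, so that nothing has to be differentiated.\<close>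

definition F_slope :: "real \<Rightarrow> real" where
  "F_slope x = (1 + \<kappa>) * ln (1 + \<kappa>) - (1 - \<kappa>) * ln (1 - \<kappa>) - 2 * \<kappa> * (ln (level \<kappa> \<beta> x) + 1)"

text \<open>\<open>F\<close> is affine minus \<open>1 - \<beta>\<close> times
  \<open>u * ln u\<close> at the affine argument \<open>level\<close>, hence concave.\<close>

lemma F_le_tangent:
  assumes "0 \<le> x" "x \<le> \<beta>" "0 \<le> y" "y \<le> \<beta>"
  shows "F \<kappa> \<beta> y \<le> F \<kappa> \<beta> x + F_slope x * (y - x)"
proof -
  let ?m = "level \<kappa> \<beta> x" and ?k = "level \<kappa> \<beta> y"
  have "(1 - \<beta>) * (?k * ln ?m + ?k - ?m) \<le> (1 - \<beta>) * (?k * ln ?k)"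
    using beta level_pos[of x] level_pos[of y] assms
    by (intro mult_left_mono mult_ln_ge_tangent) auto
  moreover have "(1 - \<beta>) * (?k * ln ?m + ?k - ?m)
      = (1 - \<beta>) * (?m * ln ?m) + ((1 - \<beta>) * ?k - (1 - \<beta>) * ?m) * (ln ?m + 1)"
    by (simp add: algebra_simps)
  moreover have "(1 - \<beta>) * ?k - (1 - \<beta>) * ?m = 2 * \<kappa> * (y - x)"
    unfolding level_mult by (simp add: algebra_simps)
  ultimately have "(1 - \<beta>) * (?m * ln ?m) + 2 * \<kappa> * (y - x) * (ln ?m + 1) \<le> (1 - \<beta>) * (?k * ln ?k)"
    by simp
  thus ?thesis unfolding F_eq F_slope_def by (simp add: algebra_simps)
qed

text \<open>The right-hand side is the logarithm of the level at which \<open>F_slope\<close>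
  vanishes. As \<open>alpha1_star\<close> may lie outside \<open>{0..\<beta>}\<close>,
  \<open>level_pos\<close> does not give the second claim.\<close>

lemma ln_level_alpha1_star:
  "ln (level \<kappa> \<beta> (alpha1_star \<kappa> \<beta>))
     = ((1 + \<kappa>) * ln (1 + \<kappa>) - (1 - \<kappa>) * ln (1 - \<kappa>)) / (2 * \<kappa>) - 1" (is ?ln)
  and level_alpha1_star_pos: "0 < level \<kappa> \<beta> (alpha1_star \<kappa> \<beta>)" (is ?pos)
proof -
  define A where "A = (1 - \<kappa>) powr (1 / (2 * \<kappa>))"
  define B where "B = sqrt (1 - \<kappa>) * (1 + \<kappa>) powr ((1 + \<kappa>) / (2 * \<kappa>))"
  have pos: "A > 0" "B > 0" using kappa by (auto simp: A_def B_def)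
  have "alpha1_star \<kappa> \<beta>
      = inverse A * ((1 - \<beta>) * B - exp 1 * A * (1 - \<beta> - \<beta> * \<kappa>)) / (2 * exp 1 * \<kappa>)"
    unfolding alpha1_star_def A_def B_def by (simp add: powr_minus mult.assoc)
  also have "\<dots> = ((1 - \<beta>) * (B / (A * exp 1)) - (1 - \<beta> - \<beta> * \<kappa>)) / (2 * \<kappa>)"
    using pos kappa by (simp add: field_simps)
  finally have "2 * \<kappa> * alpha1_star \<kappa> \<beta> = (1 - \<beta>) * (B / (A * exp 1)) - (1 - \<beta> - \<beta> * \<kappa>)"
    using kappa by simp
  hence level: "level \<kappa> \<beta> (alpha1_star \<kappa> \<beta>) = B / (A * exp 1)"
    using beta unfolding level_def by simp
  show ?pos using pos level by simp
  have "ln B = ln (1 - \<kappa>) / 2 + (1 + \<kappa>) / (2 * \<kappa>) * ln (1 + \<kappa>)"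
    unfolding B_def using kappa by (subst ln_mult) (auto simp: ln_sqrt ln_powr)
  moreover have "ln A = 1 / (2 * \<kappa>) * ln (1 - \<kappa>)"
    unfolding A_def using kappa by (simp add: ln_powr)
  ultimately show ?ln
    using pos kappa by (simp add: level ln_div ln_mult field_simps)
qed

lemma F_slope_eq:
  "F_slope x = 2 * \<kappa> * (ln (level \<kappa> \<beta> (alpha1_star \<kappa> \<beta>)) - ln (level \<kappa> \<beta> x))"
  using kappa by (simp add: F_slope_def ln_level_alpha1_star field_simps)

lemma level_mono: "x \<le> y \<Longrightarrow> level \<kappa> \<beta> x \<le> level \<kappa> \<beta> y"
  using kappa beta by (simp add: level_def divide_right_mono)

text \<open>By \<open>F_slope_eq\<close> and \<open>level_mono\<close> the slope changes sign at
  \<open>alpha1_star\<close>, so concavity puts the maximum at the point of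
  \<open>{0..\<beta>}\<close> closest to it.\<close>

lemma F_maximum:
  assumes "0 \<le> \<beta>"
  shows "\<exists>x\<in>{0, \<beta>, alpha1_star \<kappa> \<beta>}. x \<in> {0..\<beta>} \<and> (\<forall>y\<in>{0..\<beta>}. F \<kappa> \<beta> y \<le> F \<kappa> \<beta> x)"
proof -
  let ?x = "alpha1_star \<kappa> \<beta>"
  have max: "F \<kappa> \<beta> y \<le> F \<kappa> \<beta> x"
    if "x \<in> {0..\<beta>}" "y \<in> {0..\<beta>}" "F_slope x * (y - x) \<le> 0" for x y
    using F_le_tangent[of x y] that by simp
  consider "?x < 0" | "0 \<le> ?x" "?x \<le> \<beta>" | "\<beta> < ?x" by linarith
  thus ?thesis
  proof cases
    case 1
    hence "ln (level \<kappa> \<beta> ?x) \<le> ln (level \<kappa> \<beta> 0)"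
      by (simp add: ln_mono level_mono level_alpha1_star_pos)
    hence "F_slope 0 \<le> 0" using kappa by (simp add: F_slope_eq mult_nonneg_nonpos)
    thus ?thesis using max[of 0] assms by (auto intro!: bexI[of _ 0] simp: mult_nonpos_nonneg)
  next
    case 2
    thus ?thesis using max[of ?x] by (auto intro!: bexI[of _ ?x] simp: F_slope_eq)
  next
    case 3
    hence "ln (level \<kappa> \<beta> \<beta>) \<le> ln (level \<kappa> \<beta> ?x)"
      using assms by (simp add: ln_mono level_mono level_pos)
    hence "F_slope \<beta> \<ge> 0" using kappa by (simp add: F_slope_eq)
    thus ?thesis
      using max[of \<beta>] assms by (auto intro!: bexI[of _ \<beta>] simp: mult_nonneg_nonpos)
  qed
qed

section \<open>Entropy bounds when few states are nearly uniform\<close>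

lemma entropy_le_F:
  fixes q :: "'s \<Rightarrow> real" and x :: real
  assumes "finite S" "S \<noteq> {}" and nonneg: "\<And>a. a \<in> S \<Longrightarrow> 0 \<le> q a" and sum: "(\<Sum>a\<in>S. q a) = 1"
    and x: "0 \<le> x" "x \<le> \<beta>"
    and low: "x * card S \<le> card {a \<in> S. q a \<le> (1 - \<kappa>) / card S}"
    and high: "(\<beta> - x) * card S \<le> card {a \<in> S. (1 + \<kappa>) / card S \<le> q a}"
  shows "- (\<Sum>a\<in>S. q a * ln (q a)) \<le> ln (card S) + F \<kappa> \<beta> x"
proof -
  define n where "n = real (card S)"
  define m where "m = level \<kappa> \<beta> x"
  define gap where "gap = (\<lambda>u::real. u * ln u - (u * ln m + u - m))"
  let ?L = "{a \<in> S. q a \<le> (1 - \<kappa>) / n}" and ?H = "{a \<in> S. (1 + \<kappa>) / n \<le> q a}"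
  have n: "n > 0" using assms by (simp add: n_def card_gt_0_iff)
  have m: "m > 0" "1 - \<kappa> \<le> m" "m \<le> 1 + \<kappa>"
    using level_pos level_bounds x by (auto simp: m_def)
  have gap_nonneg: "gap u \<ge> 0" if "u \<ge> 0" for u
    using mult_ln_ge_tangent[OF that m(1)] by (simp add: gap_def)
  \<comment> \<open>At most one condition holds; if neither does, \<open>gap_nonneg\<close>
    suffices.\<close>
  have gap_states: "(if q a \<le> (1 - \<kappa>) / n then gap (1 - \<kappa>) else 0) + (if (1 + \<kappa>) / n \<le> q a then gap (1 + \<kappa>) else 0)
      \<le> gap (n * q a)" if "a \<in> S" for a
  proof -
    have nq: "0 \<le> n * q a" using nonneg[OF that] n by simp
    have "q a \<le> (1 - \<kappa>) / n \<longleftrightarrow> n * q a \<le> 1 - \<kappa>" "(1 + \<kappa>) / n \<le> q a \<longleftrightarrow> 1 + \<kappa> \<le> n * q a"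
      using n by (auto simp: field_simps)
    thus ?thesis
      using gap_nonneg[OF nq] tangent_gap_mono[of "n * q a" "1 - \<kappa>" m]
        tangent_gap_mono[of "n * q a" "1 + \<kappa>" m] kappa m nq
      by (auto simp: gap_def)
  qed
  have "n * (x * gap (1 - \<kappa>) + (\<beta> - x) * gap (1 + \<kappa>))
      = x * n * gap (1 - \<kappa>) + (\<beta> - x) * n * gap (1 + \<kappa>)" by (simp add: algebra_simps)
  also have "\<dots> \<le> card ?L * gap (1 - \<kappa>) + card ?H * gap (1 + \<kappa>)"
    using low high gap_nonneg kappa by (intro add_mono mult_right_mono) (auto simp: n_def)
  also have "\<dots> = (\<Sum>a\<in>S. (if q a \<le> (1 - \<kappa>) / n then gap (1 - \<kappa>) else 0) + (if (1 + \<kappa>) / n \<le> q a then gap (1 + \<kappa>) else 0))"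
    using \<open>finite S\<close> by (simp add: sum.distrib flip: sum.inter_filter)
  also have "\<dots> \<le> (\<Sum>a\<in>S. gap (n * q a))"
    by (intro sum_mono gap_states)
  also have "\<dots> = (\<Sum>a\<in>S. n * (q a * ln (q a)) + n * (ln n - ln m - 1) * q a + m)"
  proof (rule sum.cong[OF refl])
    fix a assume "a \<in> S"
    \<comment> \<open>The logarithm of the product is split for \<open>q a > 0\<close>; for
      \<open>q a = 0\<close> both sides are \<open>m\<close>.\<close>
    hence "q a = 0 \<or> q a > 0" using nonneg[of a] by auto
    thus "gap (n * q a) = n * (q a * ln (q a)) + n * (ln n - ln m - 1) * q a + m"
      using n by (auto simp: gap_def ln_mult algebra_simps)
  qed
  also have "\<dots> = n * ((\<Sum>a\<in>S. q a * ln (q a)) + ln n - ln m - 1 + m)"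
    by (simp add: sum.distrib sum flip: sum_distrib_left n_def) (simp add: algebra_simps)
  finally have main: "x * gap (1 - \<kappa>) + (\<beta> - x) * gap (1 + \<kappa>)
      \<le> (\<Sum>a\<in>S. q a * ln (q a)) + ln n - ln m - 1 + m"
    using n by simp
  \<comment> \<open>The third weight \<open>1 - \<beta>\<close> sits at \<open>m\<close>, where the
    gap is \<open>0\<close>, so this is the full mean of the gap:
    \<open>- F \<kappa> \<beta> x\<close> minus the tangent at the mean \<open>1\<close>. The nested
    \<open>1 - (1 - ...)\<close> lets \<open>level_mult\<close> be folded.\<close>
  have "x * gap (1 - \<kappa>) + (\<beta> - x) * gap (1 + \<kappa>)
      = x * ((1 - \<kappa>) * ln (1 - \<kappa>)) + (\<beta> - x) * ((1 + \<kappa>) * ln (1 + \<kappa>))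
        - (1 - (1 - (1 - \<kappa>) * x - (1 + \<kappa>) * (\<beta> - x))) * (ln m + 1) + \<beta> * m"
    by (simp add: gap_def algebra_simps)
  also have "\<dots> = - F \<kappa> \<beta> x - ln m - 1 + m"
    unfolding F_eq level_mult[symmetric] m_def by (simp add: algebra_simps)
  finally show ?thesis using main by (simp add: n_def)
qed

lemma entropy_le_Sup_F:
  fixes q :: "'s \<Rightarrow> real"
  assumes "finite S" "S \<noteq> {}" "\<And>a. a \<in> S \<Longrightarrow> 0 \<le> q a" "(\<Sum>a\<in>S. q a) = 1" "0 \<le> \<beta>"
    and few: "card {a \<in> S. q a \<in> {(1 - \<kappa>) / card S <..< (1 + \<kappa>) / card S}} \<le> (1 - \<beta>) * card S"
  shows "- (\<Sum>a\<in>S. q a * ln (q a)) \<le> ln (card S) + (SUP x\<in>{0..\<beta>}. F \<kappa> \<beta> x)"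
proof -
  define n where "n = real (card S)"
  let ?E = "{a \<in> S. q a \<in> {(1 - \<kappa>) / n <..< (1 + \<kappa>) / n}}"
  let ?L = "{a \<in> S. q a \<le> (1 - \<kappa>) / n}" and ?H = "{a \<in> S. (1 + \<kappa>) / n \<le> q a}"
  have n: "n > 0" using assms by (simp add: n_def card_gt_0_iff)
  have "card S \<le> card (?E \<union> (?L \<union> ?H))"
    using assms by (intro card_mono) auto
  also have "\<dots> \<le> card ?E + (card ?L + card ?H)"
    by (meson add_left_mono card_Un_le le_trans)
  finally have "n \<le> card ?E + (card ?L + card ?H)"
    unfolding n_def of_nat_add[symmetric] of_nat_le_iff .
  with few have many: "\<beta> * n \<le> card ?L + card ?H"
    by (simp add: n_def algebra_simps)
  \<comment> \<open>Low states fill as much of \<open>\<beta>\<close> as they can;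
    \<open>many\<close> makes the high states cover the rest.\<close>
  define x where "x = min \<beta> (card ?L / n)"
  have x: "0 \<le> x" "x \<le> \<beta>" using \<open>0 \<le> \<beta>\<close> n by (auto simp: x_def)
  have "x * n \<le> card ?L" "(\<beta> - x) * n \<le> card ?H"
    using many n by (auto simp: x_def min_def field_simps)
  hence "- (\<Sum>a\<in>S. q a * ln (q a)) \<le> ln (card S) + F \<kappa> \<beta> x"
    using entropy_le_F[OF assms(1-4) x] by (simp add: n_def)
  also have "F \<kappa> \<beta> x \<le> (SUP x\<in>{0..\<beta>}. F \<kappa> \<beta> x)"
    \<comment> \<open>The real supremum needs an upper bound, and \<open>F_nonpos\<close> supplies
      \<open>0\<close>.\<close>
    using x F_nonpos by (intro cSUP_upper bdd_aboveI2[of _ _ 0]) auto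
  finally show ?thesis by simp
qed

end

section \<open>Application to the law of the chain\<close>

lemma (in prob_space) sum_measure_law:
  assumes "finite S" "X t \<in> measurable M (count_space S)"
  shows "(\<Sum>a\<in>S. measure (law M S X t) {a}) = 1"
proof -
  interpret law: prob_space "law M S X t"
    unfolding law_def by (rule prob_space_distr[OF assms(2)])
  have "(\<Sum>a\<in>S. measure (law M S X t) {a}) = measure (law M S X t) S"
    using assms(1) by (intro law.finite_measure_eq_sum_singleton[symmetric]) (auto simp: law_def)
  thus ?thesis using law.prob_space by (simp add: law_def)
qed

theorem theorem9:
  fixes M :: "'w measure" and n :: nat
    and X :: "real \<Rightarrow> 'w \<Rightarrow> nat" and p :: "real \<Rightarrow> nat \<Rightarrow> nat \<Rightarrow> real"
    and \<kappa> \<alpha> \<beta> :: real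
  assumes "finite_ctmc M {1..n} X p"
    and "irreducible_chain {1..n} p"
    and "reversible_wrt (\<lambda>a. 1 / real n) {1..n} p"
    and "0 < \<kappa>" "\<kappa> < 1"
    and "0 < \<alpha>" "\<alpha> < 1 / 2"
    and "\<beta> = 1 / 2 - \<alpha>"
  shows "(\<forall>x\<in>{0..\<beta>}. F \<kappa> \<beta> x \<le> 0) \<and>
    (\<forall>t\<ge>0. shannon_entropy {1..n} (law M {1..n} X t) > ln (real n) + (SUP x\<in>{0..\<beta>}. F \<kappa> \<beta> x)
       \<longrightarrow> real (card (EQ \<kappa> n (law M {1..n} X t))) \<ge> \<alpha> * real n) \<and>
    (\<exists>x\<in>{0, \<beta>, alpha1_star \<kappa> \<beta>}. x \<in> {0..\<beta>} \<and> (\<forall>y\<in>{0..\<beta>}. F \<kappa> \<beta> y \<le> F \<kappa> \<beta> x)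
       \<and> F \<kappa> \<beta> x = (SUP y\<in>{0..\<beta>}. F \<kappa> \<beta> y))"
proof -
  interpret finite_ctmc M "{1..n}" X p by fact
  have \<beta>: "0 \<le> \<beta>" "\<beta> < 1 / 2" using assms by auto
  note \<kappa> = \<open>0 < \<kappa>\<close> \<open>\<kappa> < 1\<close>
  have nonpos: "\<forall>x\<in>{0..\<beta>}. F \<kappa> \<beta> x \<le> 0"
    using F_nonpos[OF \<kappa> \<beta>(2)] by simp
  have card: "real (card (EQ \<kappa> n (law M {1..n} X t))) \<ge> \<alpha> * real n"
    if "t \<ge> 0"
      and H: "shannon_entropy {1..n} (law M {1..n} X t) > ln (real n) + (SUP x\<in>{0..\<beta>}. F \<kappa> \<beta> x)" for t
  proof (rule ccontr)
    assume "\<not> ?thesis"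
    \<comment> \<open>Since \<open>1 - \<beta> = 1 / 2 + \<alpha>\<close>, the contradiction would
      already follow from a much weaker upper bound on the cardinality of \<open>EQ\<close>.\<close>
    moreover have "\<alpha> * real n \<le> (1 - \<beta>) * real n"
      using assms by (intro mult_right_mono) auto
    ultimately have few: "card (EQ \<kappa> n (law M {1..n} X t)) \<le> (1 - \<beta>) * real n" by linarith
    have sum: "(\<Sum>a\<in>{1..n}. measure (law M {1..n} X t) {a}) = 1"
      using rv \<open>t \<ge> 0\<close> by (intro sum_measure_law) auto
    \<comment> \<open>This excludes \<open>n = 0\<close>: an empty sum is not
      \<open>1\<close>.\<close>
    hence "{1..n} \<noteq> {}" by force
    hence "shannon_entropy {1..n} (law M {1..n} X t) \<le> ln (real n) + (SUP x\<in>{0..\<beta>}. F \<kappa> \<beta> x)"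
      using entropy_le_Sup_F[OF \<kappa> \<beta>(2) _ _ _ sum \<beta>(1)] few
      unfolding shannon_entropy_def EQ_def by simp
    with H show False by simp
  qed
  obtain x where x: "x \<in> {0, \<beta>, alpha1_star \<kappa> \<beta>}" "x \<in> {0..\<beta>}" "\<forall>y\<in>{0..\<beta>}. F \<kappa> \<beta> y \<le> F \<kappa> \<beta> x"
    using F_maximum[OF \<kappa> \<beta>(2,1)] by blast
  hence "F \<kappa> \<beta> x = (SUP y\<in>{0..\<beta>}. F \<kappa> \<beta> y)"
    by (intro cSup_eq_maximum[symmetric]) auto
  with nonpos card x show ?thesis by blast
qed

end
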